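(* Let $f$ be a randomized mechanism (without predictions) in the Euclidean plane that is truthful in expectation. Then the approximation ratio of $f$ is at least $1.118$; that is, if $\rho$ is such that $C(f,\mathbf{x})\le\rho\, C(o(\mathbf{x}),\mathbf{x})$ for all location profiles $\mathbf{x}$, then $\rho\ge 1.118$.
   Context: Facility location in the plane. There are $n$ agents with location profile $\mathbf{x}=\langle x_1,\dots,x_n\rangle$, $x_i\in\mathbb{R}^2$; $d$ is the Euclidean distance. A randomized mechanism $f$ assigns to every number of agents $n$ and every profile $\mathbf{x}\in(\mathbb{R}^2)^n$ a random facility location $f(\mathbf{x})$, i.e. a Borel probability distribution on $\mathbb{R}^2$. Standing assumptions on mechanisms: unanimous (if all $x_i$ equal a common point $p$, the facility is at $p$); anonymous (the outcome distribution is unchanged when the agents are permuted); scale-independent (multiplying all reported locations by the same $\lambda>0$ multiplies the random facility location by $\lambda$). Truthful in expectation: for every $\mathbf{x}$, every agent $i$ and every $x_i'\in\mathbb{R}^2$, $\mathbb{E}[d(x_i,f(\mathbf{x}))]\le\mathbb{E}[d(x_i,f(\mathbf{x}_{-i},x_i'))]$, where $(\mathbf{x}_{-i},x_i')$ is $\mathbf{x}$ with $x_i$ replaced by $x_i'$. Egalitarian social cost: $C(f,\mathbf{x})=\mathbb{E}[\max_i d(x_i,f(\mathbf{x}))]$. The optimal location $o(\mathbf{x})$ is the center of the smallest circle enclosing all the points, i.e. the minimizer of $\max_i d(x_i,y)$ over $y\in\mathbb{R}^2$, and $C(o(\mathbf{x}),\mathbf{x})$ is the optimal cost. *)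

theory Defs
  imports "HOL-Probability.Probability"
begin

type_synonym point = "real ^ 2"

text \<open>
  A location profile of \<open>n\<close> agents is a list of length \<open>n \<ge> 1\<close>; a mechanism maps a profile to the
  distribution of the facility location.  The value on the empty list is irrelevant and never
  constrained.
\<close>

type_synonym mechanism = "point list \<Rightarrow> point measure"

definition randomized_mechanism :: "mechanism \<Rightarrow> bool" where
  "randomized_mechanism f \<longleftrightarrow>
     (\<forall>xs. xs \<noteq> [] \<longrightarrow> prob_space (f xs) \<and> sets (f xs) = sets borel)"

definition unanimous :: "mechanism \<Rightarrow> bool" where
  "unanimous f \<longleftrightarrow> (\<forall>n p. n \<ge> 1 \<longrightarrow> f (replicate n p) = return borel p)"

definition anonymous :: "mechanism \<Rightarrow> bool" where
  "anonymous f \<longleftrightarrow> (\<forall>xs ys. xs \<noteq> [] \<longrightarrow> mset xs = mset ys \<longrightarrow> f xs = f ys)"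

definition scale_independent :: "mechanism \<Rightarrow> bool" where
  "scale_independent f \<longleftrightarrow>
     (\<forall>xs c. xs \<noteq> [] \<longrightarrow> c > 0 \<longrightarrow>
        f (map (\<lambda>x. c *\<^sub>R x) xs) = distr (f xs) borel (\<lambda>y. c *\<^sub>R y))"

text \<open>
  Expectations of distances are taken in \<open>[0, \<infinity>]\<close> so that they exist for every distribution; the
  Bochner integral would return 0 for a distance with infinite mean.
\<close>

definition expected_dist :: "point \<Rightarrow> point measure \<Rightarrow> ennreal" where
  "expected_dist x M = (\<integral>\<^sup>+ y. ennreal (dist x y) \<partial>M)"

definition truthful_in_expectation :: "mechanism \<Rightarrow> bool" where
  "truthful_in_expectation f \<longleftrightarrow>
     (\<forall>xs i x'. i < length xs \<longrightarrow>
        expected_dist (xs ! i) (f xs) \<le> expected_dist (xs ! i) (f (xs[i := x'])))"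

definition max_dist :: "point list \<Rightarrow> point \<Rightarrow> real" where
  "max_dist xs y = Max ((\<lambda>x. dist x y) ` set xs)"

definition egalitarian_cost :: "mechanism \<Rightarrow> point list \<Rightarrow> ennreal" where
  "egalitarian_cost f xs = (\<integral>\<^sup>+ y. ennreal (max_dist xs y) \<partial>(f xs))"

definition opt_location :: "point list \<Rightarrow> point" where
  "opt_location xs = (ARG_MIN (max_dist xs) y. True)"

lemma continuous_on_max_dist:
  assumes "xs \<noteq> []"
  shows "continuous_on UNIV (max_dist xs)"
  using assms
proof (induction xs rule: list_nonempty_induct)
  case (single x)
  have "max_dist [x] = (\<lambda>y. dist x y)"
    by (simp add: max_dist_def fun_eq_iff)
  then show ?case by (simp add: continuous_on_dist)
next
  case (cons x xs)
  have "max_dist (x # xs) = (\<lambda>y. max (dist x y) (max_dist xs y))"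
    using cons.hyps by (simp add: max_dist_def fun_eq_iff)
  then show ?case
    using continuous_on_max[OF _ cons.IH, of "\<lambda>y. dist x y"] by (simp add: continuous_on_dist)
qed

lemma max_dist_minimizer_exists:
  assumes "xs \<noteq> []"
  shows "\<exists>y. \<forall>z. max_dist xs y \<le> max_dist xs z"
proof -
  let ?p = "hd xs"
  let ?B = "cball ?p (max_dist xs ?p)"
  have p: "dist ?p z \<le> max_dist xs z" for z
    unfolding max_dist_def by (rule Max_ge) (use assms in simp_all)
  have mem: "?p \<in> ?B" using p[of ?p] by simp
  have "continuous_on ?B (max_dist xs)"
    using continuous_on_max_dist[OF assms] by (rule continuous_on_subset) simp
  moreover have "?B \<noteq> {}" using mem by (metis empty_iff)
  ultimately have "\<exists>y\<in>?B. \<forall>z\<in>?B. max_dist xs y \<le> max_dist xs z"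
    by (intro continuous_attains_inf compact_cball)
  then obtain y where "\<forall>z\<in>?B. max_dist xs y \<le> max_dist xs z" ..
  then have y: "max_dist xs y \<le> max_dist xs z" if "z \<in> ?B" for z
    using that by (rule bspec)
  have "max_dist xs y \<le> max_dist xs z" for z
  proof (cases "z \<in> ?B")
    case False
    then show ?thesis using y[OF mem] p[of z] by simp
  qed (rule y)
  then show ?thesis by blast
qed

lemma opt_location_le:
  assumes "xs \<noteq> []"
  shows "max_dist xs (opt_location xs) \<le> max_dist xs z"
proof -
  obtain y where "\<And>z. max_dist xs y \<le> max_dist xs z"
    using max_dist_minimizer_exists[OF assms] by blast
  then have "is_arg_min (max_dist xs) (\<lambda>_. True) y"
    by (simp add: is_arg_min_linorder)
  then have "is_arg_min (max_dist xs) (\<lambda>_. True) (opt_location xs)"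
    unfolding opt_location_def arg_min_def by (rule someI)
  then show ?thesis by (simp add: is_arg_min_linorder)
qed

end

theory Submission
  imports Defs
begin

text \<open>
  For agents at distance 1, the two expected distances to the facility sum to at least 1, so some
  agent has expected distance at least 1/2.  Let this agent move its report away from the other one
  until its true location \<open>m\<close> is the midpoint of a profile \<open>m - u, m + u\<close> of optimal cost
  \<open>norm u = 1\<close>.  By truthfulness the facility still has expected distance at least 1/2 from \<open>m\<close>, and
  a facility at distance \<open>r\<close> from \<open>m\<close> has cost at least \<open>sqrt (1 + r\<^sup>2)\<close> by the parallelogram law.
  By convexity the expected cost is at least \<open>sqrt (1 + (1/2)\<^sup>2) = sqrt 5 / 2\<close>.
\<close>

lemma max_dist_pair: "max_dist [a, b] y = max (dist a y) (dist b y)"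
  by (simp add: max_dist_def)

text \<open>The right-hand side is the tangent of \<open>sqrt (1 + r\<^sup>2)\<close> at \<open>r = 1/2\<close>.\<close>

lemma max_dist_antipodal_ge:
  assumes "norm u = 1"
  shows "max_dist [m - u, m + u] y \<ge> (2 + dist m y) / sqrt 5"
proof -
  let ?M = "max_dist [m - u, m + u] y" and ?r = "dist m y"
  have le: "dist (m - u) y \<le> ?M" "dist (m + u) y \<le> ?M"
    by (simp_all add: max_dist_pair)
  then have M0: "0 \<le> ?M"
    by (meson order_trans zero_le_dist)
  have "(dist (m - u) y)\<^sup>2 + (dist (m + u) y)\<^sup>2 = 2 * (norm u)\<^sup>2 + 2 * ?r\<^sup>2"
    unfolding dist_norm power2_norm_eq_inner by (simp add: algebra_simps inner_commute)
  moreover have "(dist (m - u) y)\<^sup>2 \<le> ?M\<^sup>2" "(dist (m + u) y)\<^sup>2 \<le> ?M\<^sup>2"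
    using le by (simp_all add: power_mono)
  ultimately have "1 + ?r\<^sup>2 \<le> ?M\<^sup>2"
    using assms by simp
  \<comment> \<open>The right side minus the left is \<open>(2 * ?r - 1)\<close> squared, so
    equality holds exactly at \<open>?r = 1/2\<close>.\<close>
  moreover have "(2 + ?r)\<^sup>2 \<le> 5 * (1 + ?r\<^sup>2)"
    using zero_le_power2[of "2 * ?r - 1"] by (simp add: power2_eq_square algebra_simps)
  ultimately have "((2 + ?r) / sqrt 5)\<^sup>2 \<le> ?M\<^sup>2"
    by (simp add: power_divide)
  then show ?thesis
    using M0 by (rule power2_le_imp_le)
qed

lemma expected_dist_add_ge:
  assumes "prob_space M" "sets M = sets borel"
  shows "ennreal (dist a b) \<le> expected_dist a M + expected_dist b M"
proof -
  interpret prob_space M by fact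
  note [measurable_cong] = assms(2)
  have "ennreal (dist a b) = (\<integral>\<^sup>+ y. ennreal (dist a b) \<partial>M)"
    by (simp add: emeasure_space_1)
  also have "\<dots> \<le> (\<integral>\<^sup>+ y. ennreal (dist a y) + ennreal (dist b y) \<partial>M)"
    by (intro nn_integral_mono) (simp add: dist_triangle2 flip: ennreal_plus)
  also have "\<dots> = expected_dist a M + expected_dist b M"
    unfolding expected_dist_def by (intro nn_integral_add) measurable
  finally show ?thesis .
qed

text \<open>The tangent bound is affine in \<open>dist m y\<close>, so integrating it leaves only
  \<open>expected_dist m M\<close>. This takes the place of Jensen's inequality and also covers an
  infinite mean.\<close>

lemma expected_max_dist_antipodal_ge:
  assumes "prob_space M" "sets M = sets borel" "norm u = 1"
    and "ennreal (1/2) \<le> expected_dist m M"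
  shows "ennreal (sqrt 5 / 2) \<le> (\<integral>\<^sup>+ y. ennreal (max_dist [m - u, m + u] y) \<partial>M)"
proof -
  interpret prob_space M by fact
  note [measurable_cong] = assms(2)
  have "sqrt 5 / 2 = 1 / sqrt 5 * (2 + 1/2)"
    by (simp add: field_simps)
  then have "ennreal (sqrt 5 / 2) = ennreal (1 / sqrt 5) * (ennreal 2 + ennreal (1/2))"
    by (subst ennreal_plus[symmetric], simp, simp, subst ennreal_mult[symmetric]) simp_all
  also have "\<dots> \<le> ennreal (1 / sqrt 5) * (ennreal 2 + expected_dist m M)"
    using assms(4) by (intro mult_left_mono add_left_mono) simp_all
  also have "\<dots> = (\<integral>\<^sup>+ y. ennreal (1 / sqrt 5) * (ennreal 2 + ennreal (dist m y)) \<partial>M)"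
    unfolding expected_dist_def
    by (subst nn_integral_cmult, measurable, subst nn_integral_add, measurable)
       (simp add: emeasure_space_1)
  also have "\<dots> = (\<integral>\<^sup>+ y. ennreal ((2 + dist m y) / sqrt 5) \<partial>M)"
    by (intro nn_integral_cong) (subst ennreal_plus[symmetric], simp, simp, subst ennreal_mult[symmetric], simp_all)
  also have "\<dots> \<le> (\<integral>\<^sup>+ y. ennreal (max_dist [m - u, m + u] y) \<partial>M)"
    using max_dist_antipodal_ge[OF assms(3)] by (intro nn_integral_mono ennreal_leI)
  finally show ?thesis .
qed

text \<open>A facility at the midpoint \<open>m\<close> costs 1, which bounds the optimum from
  above.\<close>

lemma approximation_ratio_ge:
  assumes "randomized_mechanism f" "norm u = 1"
    and ratio: "\<And>xs. xs \<noteq> [] \<Longrightarrow>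
      egalitarian_cost f xs \<le> ennreal (\<rho> * max_dist xs (opt_location xs))"
    and "ennreal (1/2) \<le> expected_dist m (f [m - u, m + u])"
  shows "\<rho> \<ge> sqrt 5 / 2"
proof -
  let ?xs = "[m - u, m + u]"
  let ?opt = "max_dist ?xs (opt_location ?xs)"
  have "ennreal (sqrt 5 / 2) \<le> egalitarian_cost f ?xs"
    unfolding egalitarian_cost_def using assms(1,2,4)
    by (intro expected_max_dist_antipodal_ge) (simp_all add: randomized_mechanism_def)
  also have "\<dots> \<le> ennreal (\<rho> * ?opt)"
    by (rule ratio) simp
  \<comment> \<open>\<open>ennreal\<close> sends negative reals to 0, but the left side is positive,
    so the inequality holds in the reals.\<close>
  finally have *: "sqrt 5 / 2 \<le> \<rho> * ?opt"
    by (simp add: ennreal_le_iff2)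
  have "?opt \<le> max_dist ?xs m"
    by (rule opt_location_le) simp
  then have opt1: "?opt \<le> 1"
    using assms(2) by (simp add: max_dist_pair dist_norm)
  have opt0: "0 \<le> ?opt"
    by (simp add: max_dist_pair le_max_iff_disj)
  \<comment> \<open>The sign of \<open>\<rho>\<close> is not given; it follows from the positive
    product and allows \<open>?opt\<close> to be replaced by 1.\<close>
  have "0 < \<rho> * ?opt"
    using * by (rule less_le_trans[rotated]) simp
  then have "0 \<le> \<rho>"
    using opt0 by (simp add: zero_less_mult_iff)
  then have "\<rho> * ?opt \<le> \<rho>"
    using opt1 by (intro mult_left_le)
  with * show ?thesis by simp
qed

theorem theorem3:
  fixes f :: mechanism and \<rho> :: real
  assumes "randomized_mechanism f"
    and "unanimous f"
    and "anonymous f"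
    and "scale_independent f"
    and "truthful_in_expectation f"
    and "\<And>xs. xs \<noteq> [] \<Longrightarrow>
      egalitarian_cost f xs \<le> ennreal (\<rho> * max_dist xs (opt_location xs))"
  shows "\<rho> \<ge> 1.118"
proof -
  obtain u :: point where u: "norm u = 1"
    using vector_choose_size[of 1] by auto
  let ?M = "f [0, u]"
  have truthful: "expected_dist (xs ! i) (f xs) \<le> expected_dist (xs ! i) (f (xs[i := x']))"
    if "i < length xs" for xs i x'
    using assms(5) that by (simp add: truthful_in_expectation_def)
  have "ennreal (dist 0 u) \<le> expected_dist 0 ?M + expected_dist u ?M"
    using assms(1) by (intro expected_dist_add_ge) (simp_all add: randomized_mechanism_def)
  then have sum: "1 \<le> expected_dist 0 ?M + expected_dist u ?M"
    using u by simp
  have half: "ennreal (1/2) + ennreal (1/2) = 1"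
    by (subst ennreal_plus[symmetric]) simp_all
  \<comment> \<open>Two values below 1/2 would sum to less than 1.\<close>
  have "ennreal (1/2) \<le> expected_dist 0 ?M \<or> ennreal (1/2) \<le> expected_dist u ?M"
    using sum add_strict_mono[of "expected_dist 0 ?M" "ennreal (1/2)"
        "expected_dist u ?M" "ennreal (1/2)"] half
    by (metis leD not_le)
  then have "\<exists>m. ennreal (1/2) \<le> expected_dist m (f [m - u, m + u])"
  proof
    assume "ennreal (1/2) \<le> expected_dist 0 ?M"
    also have "\<dots> \<le> expected_dist 0 (f [0 - u, 0 + u])"
      \<comment> \<open>The agent at 0 reports \<open>- u\<close>, the reflection of
        \<open>u\<close> in 0.\<close>
      using truthful[of 0 "[0, u]" "- u"] by simp
    finally show ?thesis ..
  next
    assume "ennreal (1/2) \<le> expected_dist u ?M"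
    also have "\<dots> \<le> expected_dist u (f [u - u, u + u])"
      \<comment> \<open>The agent at \<open>u\<close> reports \<open>u + u\<close>, the reflection
        of 0 in \<open>u\<close>.\<close>
      using truthful[of 1 "[0, u]" "u + u"] by simp
    finally show ?thesis ..
  qed
  then have "sqrt 5 / 2 \<le> \<rho>"
    using approximation_ratio_ge[OF assms(1) u assms(6)] by blast
  moreover have "2.236 \<le> sqrt 5"
    by (rule real_le_rsqrt) (simp add: power2_eq_square)
  ultimately show ?thesis by simp
qed

end
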